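(* Let $q=6+2\sqrt5$. The extremal $\sigma_q$-invariant polynomial $$W_{10}^{\rm E}(x,y)=x^{10}+(1350+600\sqrt5)x^6y^4-(5100+2280\sqrt5)x^4y^6+(36225+16200\sqrt5)x^2y^8+(30500+13640\sqrt5)y^{10}$$ does not satisfy the Riemann hypothesis; that is, its zeta polynomial $P(T)$ (taken with respect to $q=6+2\sqrt5$) has a root $T\in\mathbf{C}$ with $|T|\neq 1/\sqrt{q}$.
   Context: For a matrix $\sigma=\begin{pmatrix} a&b\\ c&d\end{pmatrix}$ and $f\in\mathbf{C}[x,y]$ put $f^\sigma(x,y)=f(ax+by,cx+dy)$; $f$ is called $\sigma$-invariant if $f^\sigma=f$. For real $q>0$, $q\ne1$, let $\sigma_q=\frac{1}{\sqrt q}\begin{pmatrix}1&q-1\\1&-1\end{pmatrix}$. Consider homogeneous polynomials of the form $(\ast)$: $W(x,y)=x^n+\sum_{i=d}^n A_ix^{n-i}y^i$ with $A_i\in\mathbf{C}$, $A_d\neq0$ (so $d$ is the smallest positive exponent of $y$ that occurs). Zeta polynomial: for $W$ of the form $(\ast)$ (with $d\ge 2$, and with $d^\perp\ge2$, where $d^\perp$ is the corresponding number for $W^{\sigma_q}$; if $W$ is $\sigma_q$-invariant then $d^\perp=d$), there is a unique polynomial $P(T)\in\mathbf{C}[T]$ of degree at most $n-d$ such that, expanding as a power series in $T$, the coefficient of $T^{n-d}$ in $$\frac{P(T)}{(1-T)(1-qT)}\,(y(1-T)+xT)^n$$ equals $\dfrac{W(x,y)-x^n}{q-1}$. This $P(T)$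 is the zeta polynomial of $W$ (with respect to $q$). Riemann hypothesis: a $\sigma_q$-invariant polynomial $W$ of the form $(\ast)$ satisfies the Riemann hypothesis if all roots of its zeta polynomial $P(T)$ lie on the circle $|T|=1/\sqrt q$. Extremality: let $q=6+2\sqrt5$, $\tau=\begin{pmatrix}1&0\\0&-1\end{pmatrix}$, and let $R_{6+2\sqrt5}$ be the ring of all $f\in\mathbf{C}[x,y]$ with $f^{\sigma_q}=f^\tau=f$. A polynomial $W\in R_{6+2\sqrt5}$ of the form $(\ast)$ and of even degree $n$ is called extremal if $d=2\left[\frac{n}{10}\right]+2$, where $[\cdot]$ is the floor function. One has $W_{10}^{\rm E}=\frac45\bigl(x^2+(5+2\sqrt5)y^2\bigr)^5+\frac15\psi_5(x,y)^2$ with $\psi_5(x,y)=x^5-(50+20\sqrt5)x^3y^2+(225+100\sqrt5)xy^4$; here $n=10$, $d=4$. *)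

theory Defs
  imports
    "HOL-Analysis.Analysis"
    "HOL-Computational_Algebra.Computational_Algebra"
begin

(* C[x,y] is represented as C[x][y]: the outer variable is y, so that
   coeff (coeff f j) i is the coefficient of x^i y^j in f. *)

type_synonym bpoly = "complex poly poly"

definition bconst :: "complex \<Rightarrow> bpoly" where
  "bconst c = [:[:c:]:]"

definition varx :: bpoly where
  "varx = [:[:0, 1:]:]"

definition vary :: bpoly where
  "vary = [:0, 1:]"

definition bsubst :: "bpoly \<Rightarrow> bpoly \<Rightarrow> bpoly \<Rightarrow> bpoly" where
  "bsubst f g h =
     (\<Sum>j\<le>degree f. \<Sum>i\<le>degree (coeff f j). bconst (coeff (coeff f j) i) * g ^ i * h ^ j)"

definition act :: "complex ^ 2 ^ 2 \<Rightarrow> bpoly \<Rightarrow> bpoly" where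
  "act M f = bsubst f
     (bconst (M $ 1 $ 1) * varx + bconst (M $ 1 $ 2) * vary)
     (bconst (M $ 2 $ 1) * varx + bconst (M $ 2 $ 2) * vary)"

definition invariant_under :: "complex ^ 2 ^ 2 \<Rightarrow> bpoly \<Rightarrow> bool" where
  "invariant_under M f \<longleftrightarrow> act M f = f"

definition sigma_mat :: "real \<Rightarrow> complex ^ 2 ^ 2" where
  "sigma_mat q = (1 / sqrt q) *\<^sub>R vector [vector [1, of_real (q - 1)], vector [1, -1]]"

definition tau :: "complex ^ 2 ^ 2" where
  "tau = vector [vector [1, 0], vector [0, -1]]"

definition weight_form :: "nat \<Rightarrow> nat \<Rightarrow> bpoly \<Rightarrow> bool" where
  "weight_form n d W \<longleftrightarrow> 0 < d \<and> d \<le> n \<and>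
     (\<exists>A. A d \<noteq> 0 \<and>
       W = varx ^ n + (\<Sum>i=d..n. bconst (A i) * varx ^ (n - i) * vary ^ i))"

(* Used for the number belonging to the transform of W under sigma_mat q: the coefficient
   of x^n in that transform need not be 1, so it need not satisfy weight_form. *)
definition least_y_exponent :: "bpoly \<Rightarrow> nat \<Rightarrow> bool" where
  "least_y_exponent f d \<longleftrightarrow>
     0 < d \<and> coeff f d \<noteq> 0 \<and> (\<forall>i. 0 < i \<and> i < d \<longrightarrow> coeff f i = 0)"

(* Coefficientwise embedding of C[[T]] into C[x,y][[T]]; the quotient in zeta_series is
   formed in C[[T]], where division by series with nonzero constant term is available. *)
definition fps_lift :: "complex fps \<Rightarrow> bpoly fps" where
  "fps_lift F = Abs_fps (\<lambda>k. bconst (fps_nth F k))"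

definition zeta_series :: "real \<Rightarrow> nat \<Rightarrow> complex poly \<Rightarrow> bpoly fps" where
  "zeta_series q n P =
     fps_lift (fps_of_poly P / ((1 - fps_X) * (1 - fps_const (of_real q) * fps_X)))
     * (fps_const vary * (1 - fps_X) + fps_const varx * fps_X) ^ n"

(* The numbers n and d are determined by W, through weight_form. *)
definition is_zeta_poly :: "real \<Rightarrow> bpoly \<Rightarrow> complex poly \<Rightarrow> bool" where
  "is_zeta_poly q W P \<longleftrightarrow>
     (\<exists>n d d'. weight_form n d W \<and> 2 \<le> d \<and>
        least_y_exponent (act (sigma_mat q) W) d' \<and> 2 \<le> d' \<and>
        degree P \<le> n - d \<and>
        fps_nth (zeta_series q n P) (n - d) =
          bconst (1 / (of_real q - 1)) * (W - varx ^ n))"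

definition zeta_poly :: "real \<Rightarrow> bpoly \<Rightarrow> complex poly" where
  "zeta_poly q W = (THE P. is_zeta_poly q W P)"

(* Only meaningful for W of the form weight_form n d that are invariant under sigma_mat q. *)
definition riemann_hypothesis :: "real \<Rightarrow> bpoly \<Rightarrow> bool" where
  "riemann_hypothesis q W \<longleftrightarrow>
     (\<forall>T. poly (zeta_poly q W) T = 0 \<longrightarrow> cmod T = 1 / sqrt q)"

definition q0 :: real where
  "q0 = 6 + 2 * sqrt 5"

definition R_q0 :: "bpoly set" where
  "R_q0 = {f. invariant_under (sigma_mat q0) f \<and> invariant_under tau f}"

definition extremal :: "bpoly \<Rightarrow> bool" where
  "extremal W \<longleftrightarrow> W \<in> R_q0 \<and>
     (\<exists>n d. weight_form n d W \<and> even n \<and> d = 2 * (n div 10) + 2)"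

definition W10E :: bpoly where
  "W10E = varx ^ 10
     + bconst (of_real (1350 + 600 * sqrt 5)) * varx ^ 6 * vary ^ 4
     - bconst (of_real (5100 + 2280 * sqrt 5)) * varx ^ 4 * vary ^ 6
     + bconst (of_real (36225 + 16200 * sqrt 5)) * varx ^ 2 * vary ^ 8
     + bconst (of_real (30500 + 13640 * sqrt 5)) * vary ^ 10"

end

theory Submission
  imports Defs
begin

text \<open>
  Comparing coefficients of the monomials \<open>x\<^sup>n\<^sup>-\<^sup>k y\<^sup>k\<close>, the equation defining the zeta polynomial becomes a
  triangular linear system for the first coefficients of \<open>P(T)/((1-T)(1-qT))\<close>, so that \<open>P\<close> is unique.
  For \<open>W10E\<close> the solution, written in \<open>u = T \<surd>q\<close>, is a multiple of
  \<open>1 - 2u + cu\<^sup>2 - 2u\<^sup>3 + u\<^sup>4\<close> with \<open>c = -(5 + 13 \<surd>5)/10\<close>. It is positive at \<open>u = 0\<close> and negative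
  at \<open>u = 1\<close>, which gives a real root strictly inside the circle \<open>|T| = 1/\<surd>q\<close>.
\<close>

section \<open>Scalars, monomials and substitution in C[x][y]\<close>

lemma bconst_add: "bconst (a + b) = bconst a + bconst b"
  and bconst_diff: "bconst (a - b) = bconst a - bconst b"
  and bconst_minus: "bconst (- a) = - bconst a"
  and bconst_mult: "bconst (a * b) = bconst a * bconst b"
  and bconst_0: "bconst 0 = 0"
  and bconst_1: "bconst 1 = 1"
  by (simp_all add: bconst_def flip: one_pCons)

lemma bconst_sum: "bconst (sum f A) = (\<Sum>i\<in>A. bconst (f i))"
  by (induction A rule: infinite_finite_induct) (simp_all add: bconst_0 bconst_add)

lemma bconst_of_nat: "bconst (of_nat n) = of_nat n"
  by (induction n) (simp_all add: bconst_0 bconst_1 bconst_add)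

lemma bconst_numeral: "bconst (numeral w) = numeral w"
  using bconst_of_nat[of "numeral w"] by simp

lemmas bconst_hom = bconst_add bconst_diff bconst_minus bconst_mult bconst_0 bconst_1 bconst_numeral

lemma monomial_eq_monom: "bconst c * varx ^ i * vary ^ j = monom (monom c i) j"
  by (simp add: bconst_def varx_def vary_def monom_altdef poly_const_pow)

lemma coeff_monomial:
  "coeff (bconst c * varx ^ i * vary ^ j) k = (if j = k then monom c i else 0)"
  by (simp add: monomial_eq_monom)

lemma coeff_varx_power: "coeff (varx ^ i) k = (if k = 0 then monom 1 i else 0)"
  using coeff_monomial[of 1 i 0 k] by (auto simp: bconst_1)

lemma degree_coeff_bounded:
  fixes f :: bpoly
  obtains M where "\<And>j. degree (coeff f j) \<le> M"
proof
  fix j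
  show "degree (coeff f j) \<le> (\<Sum>j\<le>degree f. degree (coeff f j))"
    by (cases "j \<le> degree f") (auto intro: member_le_sum simp: coeff_eq_0)
qed

text \<open>The ranges in \<open>bsubst\<close> depend on \<open>f\<close>. Padding with zero
  coefficients to a common rectangle lets the sums for different polynomials be added term by term,
  which is how additivity is obtained.\<close>

lemma bsubst_eq_sum:
  assumes "degree f \<le> N" and "\<And>j. degree (coeff f j) \<le> M"
  shows "bsubst f g h = (\<Sum>j\<le>N. \<Sum>i\<le>M. bconst (coeff (coeff f j) i) * g ^ i * h ^ j)"
proof -
  have "(\<Sum>i\<le>degree (coeff f j). bconst (coeff (coeff f j) i) * g ^ i * h ^ j) =
      (\<Sum>i\<le>M. bconst (coeff (coeff f j) i) * g ^ i * h ^ j)" for j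
    by (rule sum.mono_neutral_left) (use assms in \<open>auto simp: coeff_eq_0 bconst_0\<close>)
  moreover have "(\<Sum>j\<le>degree f. \<Sum>i\<le>M. bconst (coeff (coeff f j) i) * g ^ i * h ^ j) =
      (\<Sum>j\<le>N. \<Sum>i\<le>M. bconst (coeff (coeff f j) i) * g ^ i * h ^ j)"
    by (rule sum.mono_neutral_left) (use assms in \<open>auto simp: coeff_eq_0 bconst_0\<close>)
  ultimately show ?thesis
    by (simp add: bsubst_def)
qed

lemma bsubst_add: "bsubst (f1 + f2) g h = bsubst f1 g h + bsubst f2 g h"
proof -
  obtain M1 where M1: "\<And>j. degree (coeff f1 j) \<le> M1" by (rule degree_coeff_bounded) blast
  obtain M2 where M2: "\<And>j. degree (coeff f2 j) \<le> M2" by (rule degree_coeff_bounded) blast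
  define N where "N = max (degree f1) (degree f2)"
  define M where "M = max M1 M2"
  have 1: "degree (coeff f1 j) \<le> M" and 2: "degree (coeff f2 j) \<le> M" for j
    using M1[of j] M2[of j] by (auto simp: M_def)
  have 3: "degree (coeff (f1 + f2) j) \<le> M" for j
    using 1[of j] 2[of j] by (simp add: degree_add_le)
  have "degree f1 \<le> N" "degree f2 \<le> N" "degree (f1 + f2) \<le> N"
    by (auto simp: N_def degree_add_le_max)
  with 1 2 3 show ?thesis
    by (simp add: bsubst_eq_sum[of _ N M] bconst_add distrib_right sum.distrib)
qed

lemma bsubst_diff: "bsubst (f1 - f2) g h = bsubst f1 g h - bsubst f2 g h"
  using bsubst_add[of "f1 - f2" f2 g h] by simp

lemma bsubst_monomial: "bsubst (bconst c * varx ^ i * vary ^ j) g h = bconst c * g ^ i * h ^ j"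
proof -
  have "bsubst (bconst c * varx ^ i * vary ^ j) g h =
      (\<Sum>l\<le>j. \<Sum>k\<le>i. bconst (coeff (coeff (monom (monom c i) j) l) k) * g ^ k * h ^ l)"
    unfolding monomial_eq_monom
    by (rule bsubst_eq_sum) (auto simp: degree_monom_le)
  also have "\<dots> = (\<Sum>l\<le>j. \<Sum>k\<le>i. if l = j \<and> k = i then bconst c * g ^ k * h ^ l else 0)"
    by (intro sum.cong refl) (auto simp: bconst_0)
  also have "\<dots> = (\<Sum>l\<le>j. if l = j then bconst c * g ^ i * h ^ l else 0)"
    by (intro sum.cong refl) auto
  finally show ?thesis by simp
qed

section \<open>The defining power series and uniqueness of the zeta polynomial\<close>

lemma fps_lift_mult: "fps_lift (F * G) = fps_lift F * fps_lift G"
  by (simp add: fps_lift_def fps_eq_iff fps_mult_nth bconst_sum bconst_mult)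

lemma fps_lift_1: "fps_lift 1 = 1"
  by (auto simp: fps_lift_def fps_eq_iff bconst_0 bconst_1)

lemma fps_lift_X: "fps_lift fps_X = fps_X"
  by (auto simp: fps_lift_def fps_eq_iff bconst_0 bconst_1 fps_X_def)

lemma fps_lift_diff: "fps_lift (F - G) = fps_lift F - fps_lift G"
  by (simp add: fps_lift_def fps_eq_iff bconst_diff)

lemma fps_lift_power: "fps_lift (F ^ n) = fps_lift F ^ n"
  by (induction n) (simp_all add: fps_lift_1 fps_lift_mult)

definition zeta_quot :: "real \<Rightarrow> complex poly \<Rightarrow> complex fps" where
  "zeta_quot q P = fps_of_poly P / ((1 - fps_X) * (1 - fps_const (of_real q) * fps_X))"

lemma zeta_quot_mult:
  "zeta_quot q P * ((1 - fps_X) * (1 - fps_const (of_real q) * fps_X)) = fps_of_poly P"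
proof -
  have "fps_nth ((1 - fps_X) * (1 - fps_const (of_real q) * fps_X) :: complex fps) 0 \<noteq> 0"
    by simp
  then have "is_unit ((1 - fps_X) * (1 - fps_const (of_real q) * fps_X) :: complex fps)"
    by (simp only: fps_is_unit_iff not_False_eq_True)
  then show ?thesis
    unfolding zeta_quot_def by (simp only: unit_div_mult_self)
qed

lemma zeta_quot_diff: "zeta_quot q (P - R) = zeta_quot q P - zeta_quot q R"
proof -
  define Q where "Q = ((1 - fps_X) * (1 - fps_const (of_real q) * fps_X) :: complex fps)"
  have "fps_nth Q 0 \<noteq> 0" by (simp add: Q_def)
  then have "Q \<noteq> 0" by auto
  have "zeta_quot q (P - R) * Q = (zeta_quot q P - zeta_quot q R) * Q"
    unfolding left_diff_distrib unfolding Q_def zeta_quot_mult by (simp add: fps_of_poly_diff)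
  with \<open>Q \<noteq> 0\<close> show ?thesis by simp
qed

text \<open>In the binomial expansion of \<open>(y(1-T) + xT)^n\<close> the power \<open>y^k\<close>
  occurs only with \<open>x^(n-k)\<close> and carries \<open>T^(n-k) (1-T)^k\<close>. So the
  polynomial identity splits into one scalar equation over C for each \<open>k\<close>.\<close>

lemma coeff_zeta_series:
  "coeff (fps_nth (zeta_series q n P) m) k =
    (if k \<le> n then monom (of_nat (n choose k) *
      fps_nth (zeta_quot q P * (fps_X ^ (n - k) * (1 - fps_X) ^ k)) m) (n - k) else 0)"
proof -
  let ?F = "zeta_quot q P"
  have "zeta_series q n P = fps_lift ?F *
      (\<Sum>j\<le>n. of_nat (n choose j) * (fps_const vary * (1 - fps_X)) ^ j
        * (fps_const varx * fps_X) ^ (n - j))"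
    unfolding zeta_series_def zeta_quot_def by (simp only: binomial_ring)
  also have "\<dots> = (\<Sum>j\<le>n. fps_const (of_nat (n choose j) * varx ^ (n - j) * vary ^ j)
      * fps_lift (?F * (fps_X ^ (n - j) * (1 - fps_X) ^ j)))"
    by (simp add: sum_distrib_left power_mult_distrib fps_lift_mult fps_lift_power
        fps_lift_diff fps_lift_1 fps_lift_X fps_const_power fps_of_nat mult_ac
        flip: fps_const_mult)
  finally have "fps_nth (zeta_series q n P) m =
      (\<Sum>j\<le>n. of_nat (n choose j) * varx ^ (n - j) * vary ^ j
        * bconst (fps_nth (?F * (fps_X ^ (n - j) * (1 - fps_X) ^ j)) m))"
    by (simp add: fps_sum_nth fps_lift_def)
  also have "\<dots> = (\<Sum>j\<le>n. bconst (of_nat (n choose j) *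
      fps_nth (?F * (fps_X ^ (n - j) * (1 - fps_X) ^ j)) m) * varx ^ (n - j) * vary ^ j)"
    by (simp add: bconst_mult bconst_of_nat mult_ac)
  finally show ?thesis
    by (simp add: coeff_sum coeff_monomial)
qed

text \<open>The scalar equations are triangular with unit diagonal in the coefficients of the
  quotient series, so they fix these up to index \<open>m\<close>. Multiplying by the denominator
  fixes the numerator up to degree \<open>m\<close>, which is all of it.\<close>

lemma zeta_series_nth_inj:
  assumes eq: "fps_nth (zeta_series q n P) m = fps_nth (zeta_series q n R) m"
    and "m \<le> n" "degree P \<le> m" "degree R \<le> m"
  shows "P = R"
proof -
  define D where "D = zeta_quot q (P - R)"
  have D0: "fps_nth (D * (fps_X ^ j * (1 - fps_X) ^ (n - j))) m = 0" if "j \<le> m" for j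
  proof -
    have "n - (n - j) = j" and "\<not> n < n - j" using that \<open>m \<le> n\<close> by simp_all
    \<comment> \<open>The monomial compared is \<open>x^j y^(n-j)\<close>; its binomial coefficient
      is nonzero in C and cancels.\<close>
    with arg_cong[OF eq, of "\<lambda>f. coeff (coeff f (n - j)) j"]
    have "fps_nth (zeta_quot q P * (fps_X ^ j * (1 - fps_X) ^ (n - j))) m =
        fps_nth (zeta_quot q R * (fps_X ^ j * (1 - fps_X) ^ (n - j))) m"
      by (simp add: coeff_zeta_series)
    then show ?thesis
      by (simp add: D_def zeta_quot_diff left_diff_distrib)
  qed
  have D: "fps_nth D k = 0" if "k \<le> m" for k
    using that
  proof (induction k rule: less_induct)
    case (less k)
    let ?G = "(1 - fps_X) ^ (n - (m - k)) :: complex fps"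
    \<comment> \<open>With \<open>j = m - k\<close> the equation concerns the \<open>T^k\<close>
      coefficient of \<open>D * ?G\<close>. The earlier coefficients of \<open>D\<close> vanish by
      induction and \<open>?G\<close> has constant term 1, so only the \<open>k\<close>-th
      coefficient of \<open>D\<close> survives.\<close>
    have "fps_nth (fps_X ^ (m - k) * (D * ?G)) m = 0"
      using D0[of "m - k"] by (simp add: mult_ac)
    moreover have "m - (m - k) = k" "\<not> m < m - k" using less.prems by simp_all
    ultimately have "0 = fps_nth (D * ?G) k"
      by (simp only: fps_X_power_mult_nth if_False)
    also have "\<dots> = (\<Sum>i\<in>{0..k}. fps_nth D i * fps_nth ?G (k - i))"
      by (simp add: fps_mult_nth)
    also have "\<dots> = (\<Sum>i\<in>{k}. fps_nth D i * fps_nth ?G (k - i))"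
      by (rule sum.mono_neutral_right) (use less in auto)
    also have "\<dots> = fps_nth D k" by (simp add: fps_power_zeroth)
    finally show ?case by simp
  qed
  have "coeff (P - R) k = 0" for k
  proof (cases "k \<le> m")
    case True
    then have "fps_nth (fps_of_poly (P - R)) k = 0"
      unfolding zeta_quot_mult[of q, symmetric] D_def[symmetric]
      by (subst fps_mult_nth) (auto intro!: sum.neutral simp: D)
    then show ?thesis by simp
  next
    case False
    with assms show ?thesis by (simp add: coeff_eq_0)
  qed
  then show ?thesis by (simp add: poly_eq_iff)
qed

section \<open>The numbers n and d attached to W\<close>

lemma weight_form_coeff:
  assumes "weight_form n d W"
  shows "coeff W 0 = monom 1 n" "coeff W d \<noteq> 0" "\<And>i. 0 < i \<Longrightarrow> i < d \<Longrightarrow> coeff W i = 0"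
proof -
  obtain A where A: "A d \<noteq> 0" "0 < d" "d \<le> n" and
    W: "W = varx ^ n + (\<Sum>i=d..n. bconst (A i) * varx ^ (n - i) * vary ^ i)"
    using assms by (auto simp: weight_form_def)
  show "coeff W 0 = monom 1 n" "coeff W d \<noteq> 0" "\<And>i. 0 < i \<Longrightarrow> i < d \<Longrightarrow> coeff W i = 0"
    unfolding W using A by (auto simp: coeff_sum coeff_monomial coeff_varx_power)
qed

text \<open>The \<open>y^0\<close> part is \<open>x^n\<close>, which reveals \<open>n\<close>, and
  \<open>d\<close> is the least positive exponent of \<open>y\<close>. This makes the existential
  quantifiers in \<open>is_zeta_poly\<close> harmless.\<close>

lemma weight_form_unique:
  assumes "weight_form n d W" "weight_form n' d' W"
  shows "n = n'" "d = d'"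
proof -
  have "monom (1::complex) n = monom 1 n'"
    using assms[THEN weight_form_coeff(1)] by simp
  then show "n = n'"
    by (metis degree_monom_eq zero_neq_one)
  have "0 < d" "0 < d'" using assms by (auto simp: weight_form_def)
  then show "d = d'"
    using assms[THEN weight_form_coeff(2)] weight_form_coeff(3)[OF assms(1), of d']
      weight_form_coeff(3)[OF assms(2), of d] by (meson linorder_neqE_nat)
qed

lemma weight_form_least_y_exponent:
  "weight_form n d W \<Longrightarrow> least_y_exponent W d"
  using weight_form_coeff[of n d W] by (simp add: least_y_exponent_def weight_form_def[of n d W])

text \<open>An invariant \<open>W\<close> is its own transform, so \<open>d\<close> itself serves as
  the witness for \<open>d'\<close>.\<close>

lemma is_zeta_poly_invariant_iff:
  assumes "weight_form n d W" "2 \<le> d" "invariant_under (sigma_mat q) W"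
  shows "is_zeta_poly q W P \<longleftrightarrow> degree P \<le> n - d \<and>
    fps_nth (zeta_series q n P) (n - d) = bconst (1 / (of_real q - 1)) * (W - varx ^ n)"
  using assms weight_form_unique[OF assms(1)] weight_form_least_y_exponent[OF assms(1)]
  unfolding is_zeta_poly_def invariant_under_def by metis

lemma is_zeta_poly_unique:
  assumes "is_zeta_poly q W P" "is_zeta_poly q W R"
  shows "P = R"
  using assms weight_form_unique unfolding is_zeta_poly_def
  by (metis diff_le_self zeta_series_nth_inj)

section \<open>Invariance and extremality of W10E\<close>

lemma W10_homogeneous:
  fixes g h t a b c d :: "'a::comm_ring_1"
  shows "(t * g) ^ 10 + a * (t * g) ^ 6 * (t * h) ^ 4 - b * (t * g) ^ 4 * (t * h) ^ 6
      + c * (t * g) ^ 2 * (t * h) ^ 8 + d * (t * h) ^ 10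
    = t ^ 10 * (g ^ 10 + a * g ^ 6 * h ^ 4 - b * g ^ 4 * h ^ 6 + c * g ^ 2 * h ^ 8 + d * h ^ 10)"
  by (simp add: eval_nat_numeral algebra_simps)

text \<open>Here \<open>5 + 2 * r\<close> stands for \<open>q - 1\<close> and \<open>1 + r\<close>
  for the square root of \<open>q\<close>. The substitution is \<open>sigma_mat\<close> without its
  scalar factor, so the form is an eigenvector with eigenvalue \<open>q\<close>.\<close>

lemma quadratic_transform:
  fixes x y r :: "'a::comm_ring_1"
  assumes "r * r = 5"
  shows "(x + (5 + 2 * r) * y) ^ 2 + (5 + 2 * r) * (x - y) ^ 2
    = (1 + r) ^ 2 * (x ^ 2 + (5 + 2 * r) * y ^ 2)"
proof -
  \<comment> \<open>\<open>algebra_simps\<close> nests products to the right, so squares of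
    \<open>r\<close> inside longer monomials need this second form of the rule.\<close>
  have rr: "r * (r * z) = 5 * z" for z using assms by (simp flip: mult.assoc)
  show ?thesis
   by (simp add: power2_eq_square algebra_simps rr assms)
qed

text \<open>The quintic is \<psi>_5; the eigenvalue is the fifth power of the square root of
  \<open>q\<close>, so \<psi>_5 is itself invariant under the normalised matrix.\<close>

lemma psi5_transform:
  fixes x y r :: "'a::comm_ring_1"
  assumes "r * r = 5"
  shows "(x + (5 + 2 * r) * y) ^ 5
      - (50 + 20 * r) * (x + (5 + 2 * r) * y) ^ 3 * (x - y) ^ 2
      + (225 + 100 * r) * (x + (5 + 2 * r) * y) * (x - y) ^ 4
    = (1 + r) ^ 5 * (x ^ 5 - (50 + 20 * r) * x ^ 3 * y ^ 2 + (225 + 100 * r) * x * y ^ 4)"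
proof -
  have rr: "r * (r * z) = 5 * z" for z using assms by (simp flip: mult.assoc)
  show ?thesis
   by (simp add: eval_nat_numeral algebra_simps rr assms)
qed
text \<open>The known expression of \<open>W10E\<close> as 4/5 of a fifth power plus 1/5 of \<psi>_5
  squared, multiplied by 5 to avoid fractions in the ring.\<close>

lemma W10_decomposition:
  fixes x y r :: "'a::comm_ring_1"
  assumes "r * r = 5"
  shows "5 * (x ^ 10 + (1350 + 600 * r) * x ^ 6 * y ^ 4 - (5100 + 2280 * r) * x ^ 4 * y ^ 6
      + (36225 + 16200 * r) * x ^ 2 * y ^ 8 + (30500 + 13640 * r) * y ^ 10)
    = 4 * (x ^ 2 + (5 + 2 * r) * y ^ 2) ^ 5
      + (x ^ 5 - (50 + 20 * r) * x ^ 3 * y ^ 2 + (225 + 100 * r) * x * y ^ 4) ^ 2"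
proof -
  have rr: "r * (r * z) = 5 * z" for z using assms by (simp flip: mult.assoc)
  show ?thesis
   by (simp add: eval_nat_numeral algebra_simps rr assms)
qed

definition W10_coeff :: "nat \<Rightarrow> complex" where
  "W10_coeff i = of_real (if i = 4 then 1350 + 600 * sqrt 5 else if i = 6 then - (5100 + 2280 * sqrt 5)
     else if i = 8 then 36225 + 16200 * sqrt 5 else if i = 10 then 30500 + 13640 * sqrt 5 else 0)"

lemma W10E_eq_sum:
  "W10E = varx ^ 10 + (\<Sum>i=4..10. bconst (W10_coeff i) * varx ^ (10 - i) * vary ^ i)"
proof -
  have "{4..10} = {4, 5, 6, 7, 8, 9, 10::nat}" by auto
  then show ?thesis
    by (simp add: W10E_def W10_coeff_def bconst_hom algebra_simps)
qed

lemma weight_form_W10E: "weight_form 10 4 W10E"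
proof -
  have "1350 + 600 * sqrt 5 > 0" by (simp add: add_pos_nonneg)
  then have "W10_coeff 4 \<noteq> 0" by (simp add: W10_coeff_def del: of_real_add)
  then show ?thesis
    unfolding weight_form_def using W10E_eq_sum by auto
qed

lemma bsubst_W10E:
  defines "r \<equiv> bconst (of_real (sqrt 5))"
  shows "bsubst W10E g h = g ^ 10 + (1350 + 600 * r) * g ^ 6 * h ^ 4
    - (5100 + 2280 * r) * g ^ 4 * h ^ 6 + (36225 + 16200 * r) * g ^ 2 * h ^ 8
    + (30500 + 13640 * r) * h ^ 10"
proof -
  have "bsubst (varx ^ 10) g h = g ^ 10"
    using bsubst_monomial[of 1 10 0 g h] by (simp add: bconst_1)
  moreover have y: "bsubst (bconst c * vary ^ 10) g h = bconst c * h ^ 10" for c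
    using bsubst_monomial[of c 0 10 g h] by simp
  ultimately show ?thesis
    unfolding W10E_def bsubst_add bsubst_diff bsubst_monomial y
    by (simp only: bconst_hom r_def of_real_add of_real_mult of_real_numeral)
qed

lemma W10E_alt:
  defines "r \<equiv> bconst (of_real (sqrt 5))"
  shows "W10E = varx ^ 10 + (1350 + 600 * r) * varx ^ 6 * vary ^ 4
    - (5100 + 2280 * r) * varx ^ 4 * vary ^ 6 + (36225 + 16200 * r) * varx ^ 2 * vary ^ 8
    + (30500 + 13640 * r) * vary ^ 10"
  by (simp add: W10E_def bconst_hom r_def)

lemma sqrt_q0: "sqrt q0 = 1 + sqrt 5"
proof -
  have "(1 + sqrt 5)\<^sup>2 = q0" by (simp add: q0_def power2_eq_square algebra_simps)
  then show ?thesis by (rule real_sqrt_unique) simp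
qed

lemma complex_sqrt5_squared: "complex_of_real (sqrt 5) * complex_of_real (sqrt 5) = 5"
  by (simp only: real_sqrt_mult_self abs_numeral of_real_numeral flip: of_real_mult)

text \<open>Both blocks of the decomposition are eigenvectors of the unnormalised substitution, so
  \<open>W10E\<close> acquires \<open>(1 + r)^10\<close>. Homogeneity yields \<open>t^10\<close>
  from the normalisation, and \<open>t * (1 + r) = 1\<close>.\<close>

lemma sigma_invariant_W10E: "invariant_under (sigma_mat q0) W10E"
proof -
  define r where "r = bconst (of_real (sqrt 5))"
  define t where "t = bconst (of_real (1 / sqrt q0))"
  define g where "g = varx + (5 + 2 * r) * vary"
  define h where "h = varx - vary"
  have r: "r * r = 5"
    by (simp only: r_def complex_sqrt5_squared bconst_numeral flip: bconst_mult)
  have "1 + sqrt 5 > 0" by (simp add: add_pos_pos)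
  then have "1 / sqrt q0 * (1 + sqrt 5) = 1" by (simp add: sqrt_q0)
  then have "of_real (1 / sqrt q0) * (1 + of_real (sqrt 5)) = (1 :: complex)"
    by (metis of_real_1 of_real_add of_real_mult)
  then have t: "t * (1 + r) = 1"
    by (metis t_def r_def bconst_mult bconst_add bconst_1)
  have q: "complex_of_real (q0 - 1) = 5 + 2 * of_real (sqrt 5)"
    by (simp add: q0_def)
  have entries: "sigma_mat q0 $ 1 $ 1 = of_real (1 / sqrt q0)"
    "sigma_mat q0 $ 1 $ 2 = of_real (1 / sqrt q0) * (5 + 2 * of_real (sqrt 5))"
    "sigma_mat q0 $ 2 $ 1 = of_real (1 / sqrt q0)"
    "sigma_mat q0 $ 2 $ 2 = - of_real (1 / sqrt q0)"
    unfolding sigma_mat_def q by (simp_all add: vector_scaleR_component)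
      (simp_all add: scaleR_conv_of_real)
  have act: "act (sigma_mat q0) W10E = bsubst W10E (t * g) (t * h)"
    unfolding act_def entries bconst_hom t_def[symmetric] r_def[symmetric] g_def h_def
    by (simp add: right_diff_distrib distrib_left[of t varx] mult.assoc)
  have factor: "4 * (u ^ 2 * a) ^ 5 + (u ^ 5 * b) ^ 2 = u ^ 10 * (4 * a ^ 5 + b ^ 2)" for u a b :: bpoly
    by (simp add: power_mult_distrib distrib_left mult_ac flip: power_mult)
  \<comment> \<open>The decomposition is applied on both sides, once to \<open>g\<close>,
    \<open>h\<close> and once to \<open>varx\<close>, \<open>vary\<close>; the factor 5 then cancels
    in C[x][y].\<close>
  have "5 * bsubst W10E g h = 5 * ((1 + r) ^ 10 * W10E)"
    unfolding bsubst_W10E unfolding W10E_alt r_def[symmetric]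
    unfolding mult.left_commute[of 5 "(1 + r) ^ 10"] W10_decomposition[OF r]
    unfolding g_def h_def quadratic_transform[OF r] psi5_transform[OF r]
    by (rule factor)
  then have gh: "bsubst W10E g h = (1 + r) ^ 10 * W10E" by simp
  have "bsubst W10E (t * g) (t * h) = t ^ 10 * bsubst W10E g h"
    unfolding bsubst_W10E by (rule W10_homogeneous)
  also have "\<dots> = (t * (1 + r)) ^ 10 * W10E"
    by (simp add: gh power_mult_distrib)
  finally show ?thesis
    by (simp add: invariant_under_def act t)
qed

lemma tau_invariant_W10E: "invariant_under tau W10E"
  unfolding invariant_under_def act_def bsubst_W10E
  by (simp add: tau_def bconst_hom W10E_alt)

lemma extremal_W10E: "extremal W10E"
proof -
  have "\<exists>n d. weight_form n d W10E \<and> even n \<and> d = 2 * (n div 10) + 2"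
    by (rule exI[of _ 10], rule exI[of _ 4]) (simp add: weight_form_W10E)
  then show ?thesis
    by (simp add: extremal_def R_q0_def sigma_invariant_W10E tau_invariant_W10E)
qed

section \<open>The zeta polynomial of W10E\<close>

text \<open>Multiplying the quotient by its denominator \<open>1 - (1+q)T + qT^2\<close> gives a
  two-term recurrence for its coefficients.\<close>

lemma zeta_quot_nth:
  shows "fps_nth (zeta_quot q P) 0 = coeff P 0"
    and "fps_nth (zeta_quot q P) (Suc 0) = coeff P (Suc 0) + (1 + of_real q) * fps_nth (zeta_quot q P) 0"
    and "fps_nth (zeta_quot q P) (Suc (Suc k)) = coeff P (Suc (Suc k))
      + (1 + of_real q) * fps_nth (zeta_quot q P) (Suc k) - of_real q * fps_nth (zeta_quot q P) k"
proof -
  define F where "F = zeta_quot q P"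
  have "F * ((1 - fps_X) * (1 - fps_const (of_real q) * fps_X)) =
      F - fps_const (1 + of_real q) * (fps_X * F) + fps_const (of_real q) * (fps_X * (fps_X * F))"
    by (simp only: fps_const_add[symmetric] fps_const_1_eq_1) (simp add: algebra_simps)
  then have "fps_of_poly P =
      F - fps_const (1 + of_real q) * (fps_X * F) + fps_const (of_real q) * (fps_X * (fps_X * F))"
    by (simp only: F_def zeta_quot_mult)
  from arg_cong[OF this, of fps_nth]
  have *: "coeff P m = fps_nth F m - (1 + of_real q) * fps_nth (fps_X * F) m
      + of_real q * fps_nth (fps_X * (fps_X * F)) m" for m
    by (simp add: fun_eq_iff)
  show "fps_nth F 0 = coeff P 0"
    and "fps_nth F (Suc 0) = coeff P (Suc 0) + (1 + of_real q) * fps_nth F 0"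
    and "fps_nth F (Suc (Suc k)) = coeff P (Suc (Suc k))
      + (1 + of_real q) * fps_nth F (Suc k) - of_real q * fps_nth F k"
    using *[of 0] *[of "Suc 0"] *[of "Suc (Suc k)"] by simp_all
qed

lemma one_minus_fps_X_power_nth:
  "fps_nth ((1 - fps_X) ^ n) k = (- 1) ^ k * (of_nat (n choose k) :: 'a::comm_ring_1)"
proof -
  have "fps_nth ((1 - fps_X) ^ n) k = fps_nth ((- fps_X + 1 :: 'a fps) ^ n) k" by simp
  also have "\<dots> = (\<Sum>j\<le>n. fps_nth (fps_const ((- 1) ^ j * of_nat (n choose j)) * fps_X ^ j) k)"
    unfolding binomial_ring
    by (simp add: fps_sum_nth power_minus[of fps_X] mult_ac flip: fps_const_mult fps_const_power fps_const_neg fps_of_nat)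
  also have "\<dots> = (\<Sum>j\<le>n. if j = k then (- 1) ^ j * of_nat (n choose j) else 0)"
    by (intro sum.cong refl) (auto simp: fps_X_power_nth)
  finally show ?thesis by (simp add: binomial_eq_0)
qed

text \<open>This is \<open>(5 + 2 * sqrt 5) / 7\<close> times the quartic in
  \<open>u = T * sqrt q\<close> described at the start, rewritten in \<open>T\<close>. It is kept
  over the reals so that the intermediate value theorem applies.\<close>

definition W10_zeta :: "real poly" where
  "W10_zeta = smult (1 / 7) [:5 + 2 * sqrt 5, - (30 + 14 * sqrt 5), - (168 + 76 * sqrt 5),
     - (320 + 144 * sqrt 5), 520 + 232 * sqrt 5:]"

text \<open>The recurrence produces the coefficients of the quotient up to \<open>T^6\<close>, where
  \<open>6 = n - d\<close>, and the scalar equations for \<open>y^4\<close> to \<open>y^10\<close>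
  are then checked one by one in Q(\<open>sqrt 5\<close>).\<close>

lemma is_zeta_poly_W10E: "is_zeta_poly q0 W10E (map_poly of_real W10_zeta)"
proof -
  define P :: "complex poly" where "P = map_poly of_real W10_zeta"
  define r where "r = complex_of_real (sqrt 5)"
  define F where "F = zeta_quot q0 P"
  have r: "r * r = 5" "r * (r * z) = 5 * z" for z
    by (simp_all add: r_def complex_sqrt5_squared flip: mult.assoc)
  have q: "complex_of_real q0 = 6 + 2 * r"
    by (simp add: q0_def r_def)
  \<comment> \<open>\<open>q - 1 = 5 + 2r\<close> has norm \<open>25 - 4 * 5 = 5\<close> over the
    rationals; rationalising keeps all later checks linear in \<open>r\<close>.\<close>
  have inv: "1 / (complex_of_real q0 - 1) = (5 - 2 * r) / 5"
  proof -
    have "(complex_of_real q0 - 1) * (5 - 2 * r) = 5"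
      by (simp add: q algebra_simps r)
    then show ?thesis
      by (metis divide_eq_eq mult.commute nonzero_divide_eq_eq zero_neq_numeral mult_zero_left
          times_divide_eq_left mult_1)
  qed
  have deg: "degree P \<le> 6"
    by (simp add: P_def W10_zeta_def map_poly_pCons degree_pCons_eq_if)
  have P: "coeff P 0 = (5 + 2 * r) / 7" "coeff P (Suc 0) = - (30 + 14 * r) / 7"
    "coeff P 2 = - (168 + 76 * r) / 7" "coeff P 3 = - (320 + 144 * r) / 7"
    "coeff P 4 = (520 + 232 * r) / 7" "coeff P 5 = 0" "coeff P 6 = 0"
    by (simp_all add: P_def W10_zeta_def coeff_map_poly r_def coeff_pCons eval_nat_numeral)
  have rec:
    "fps_nth F 2 = coeff P 2 + (1 + of_real q0) * fps_nth F (Suc 0) - of_real q0 * fps_nth F 0"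
    "fps_nth F 3 = coeff P 3 + (1 + of_real q0) * fps_nth F 2 - of_real q0 * fps_nth F (Suc 0)"
    "fps_nth F 4 = coeff P 4 + (1 + of_real q0) * fps_nth F 3 - of_real q0 * fps_nth F 2"
    "fps_nth F 5 = coeff P 5 + (1 + of_real q0) * fps_nth F 4 - of_real q0 * fps_nth F 3"
    "fps_nth F 6 = coeff P 6 + (1 + of_real q0) * fps_nth F 5 - of_real q0 * fps_nth F 4"
    by (simp_all add: F_def eval_nat_numeral zeta_quot_nth(3))
  have F0: "fps_nth F 0 = (5 + 2 * r) / 7"
    using zeta_quot_nth(1)[of q0 P] by (simp add: F_def P)
  have F1: "fps_nth F (Suc 0) = (25 + 10 * r) / 7"
    unfolding zeta_quot_nth(2)[of q0 P, folded F_def] P F0 q by (simp add: field_simps r)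
  have F2: "fps_nth F 2 = (57 + 22 * r) / 7"
    unfolding rec(1) P F0 F1 q by (simp add: field_simps r)
  have F3: "fps_nth F 3 = 7 + 2 * r"
    unfolding rec(2) P F1 F2 q by (simp add: field_simps r)
  have F4: "fps_nth F 4 = 63 + 26 * r"
    unfolding rec(3) P F2 F3 q by (simp add: field_simps r)
  have F5: "fps_nth F 5 = 639 + 282 * r"
    unfolding rec(4) P F3 F4 q by (simp add: field_simps r)
  have F6: "fps_nth F 6 = 6655 + 2970 * r"
    unfolding rec(5) P F4 F5 q by (simp add: field_simps r)
  \<comment> \<open>The factor \<open>T^(10-k)\<close> has been removed, lowering the index from 6
    to \<open>k - 4\<close>.\<close>
  have A: "of_nat (10 choose k) * fps_nth (F * (1 - fps_X) ^ k) (k - 4) =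
      1 / (of_real q0 - 1) * W10_coeff k" if "k \<in> {4..10}" for k
  proof -
    have "k \<in> {4, 5, 6, 7, 8, 9, 10}" using that by auto
    moreover have *: "{0..Suc 0} = {0, 1}" "{0..2::nat} = {0, 1, 2}" "{0..3::nat} = {0, 1, 2, 3}"
      "{0..4::nat} = {0, 1, 2, 3, 4}" "{0..5::nat} = {0, 1, 2, 3, 4, 5}"
      "{0..6::nat} = {0, 1, 2, 3, 4, 5, 6}"
      by auto
    ultimately show ?thesis
      unfolding inv
      by (elim insertE emptyE)
        (simp_all add: fps_mult_nth one_minus_fps_X_power_nth F0 F1 F2 F3 F4 F5 F6 *
          W10_coeff_def r_def[symmetric] binomial_code fold_atLeastAtMost_nat.simps fact_numeral field_simps r
          flip: numeral_2_eq_2)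
  qed
  have shift: "fps_nth (F * (fps_X ^ a * G)) m = (if m < a then 0 else fps_nth (F * G) (m - a))" for a G m
    by (simp add: mult.left_commute[of F] fps_X_power_mult_nth)
  have "coeff (fps_nth (zeta_series q0 10 P) 6) k =
      coeff (bconst (1 / (of_real q0 - 1)) * (W10E - varx ^ 10)) k" for k
  proof -
    have "coeff (bconst (1 / (of_real q0 - 1)) * (W10E - varx ^ 10)) k =
        (\<Sum>i=4..10. coeff (bconst (1 / (of_real q0 - 1) * W10_coeff i) * varx ^ (10 - i) * vary ^ i) k)"
      by (simp only: W10E_eq_sum add_diff_cancel_left' sum_distrib_left coeff_sum bconst_mult mult.assoc)
    also have "\<dots> = (if k \<in> {4..10} then
        monom (1 / (of_real q0 - 1) * W10_coeff k) (10 - k) else 0)"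
      unfolding coeff_monomial by (simp add: sum.delta)
    also have "\<dots> = coeff (fps_nth (zeta_series q0 10 P) 6) k"
    proof (cases "k \<in> {4..10}")
      case True
      then have "\<not> 6 < 10 - k" "6 - (10 - k) = k - 4" "k \<le> 10" by auto
      with A[OF True] True show ?thesis
        by (simp add: coeff_zeta_series shift flip: F_def)
    next
      \<comment> \<open>For \<open>k < 4\<close> the factor \<open>T^(10-k)\<close> has order above
        6, and for \<open>k > 10\<close> no term exists, so both sides vanish.\<close>
      case False
      then show ?thesis
        by (auto simp: coeff_zeta_series shift simp flip: F_def)
    qed
    finally show ?thesis ..
  qed
  then show ?thesis
    using deg weight_form_W10E sigma_invariant_W10E unfolding P_def[symmetric]
    by (simp add: is_zeta_poly_invariant_iff[OF weight_form_W10E] poly_eq_iff)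
qed

section \<open>A root off the circle\<close>

lemma W10_zeta_real_root: "\<exists>x. 0 < x \<and> x < 1 / sqrt q0 \<and> poly W10_zeta x = 0"
proof -
  define r where "r = sqrt 5"
  have r: "r * r = 5" "r * (r * z) = 5 * z" for z
    by (simp_all add: r_def flip: mult.assoc)
  have "(1 + sqrt 5) * (sqrt 5 - 1) = 4" by (simp add: algebra_simps)
  moreover have pos: "1 + sqrt 5 > 0" by (simp add: add_pos_pos)
  ultimately have s: "1 / sqrt q0 = (sqrt 5 - 1) / 4"
    unfolding sqrt_q0 by (simp add: field_simps)
  \<comment> \<open>This is the value at \<open>u = 1\<close>, namely
    \<open>(5 + 2 * sqrt 5) / 7\<close> times \<open>c - 2\<close>.\<close>
  have "poly W10_zeta (1 / sqrt q0) = - (51 + 23 * sqrt 5) / 14"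
    unfolding s W10_zeta_def r_def[symmetric] by (simp add: field_simps r)
  also have "\<dots> < 0"
    using real_sqrt_gt_zero[of 5] by (simp del: real_sqrt_gt_0_iff)
  finally have "poly W10_zeta (1 / sqrt q0) < 0" .
  moreover have "poly W10_zeta 0 > 0" by (simp add: W10_zeta_def add_pos_pos)
  moreover have "0 < 1 / sqrt q0" using pos by (simp add: sqrt_q0)
  ultimately show ?thesis
    using poly_IVT_neg by blast
qed

theorem theorem3p1:
  shows "extremal W10E \<and> invariant_under (sigma_mat q0) W10E \<and>
    (\<exists>!P. is_zeta_poly q0 W10E P) \<and>
    \<not> riemann_hypothesis q0 W10E \<and>
    (\<exists>T. poly (zeta_poly q0 W10E) T = 0 \<and> cmod T \<noteq> 1 / sqrt q0)"
proof -
  have ex1: "\<exists>!P. is_zeta_poly q0 W10E P"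
    using is_zeta_poly_W10E is_zeta_poly_unique by blast
  \<comment> \<open>Existence and uniqueness turn the definite description into the explicit
    quartic.\<close>
  then have zeta: "zeta_poly q0 W10E = map_poly of_real W10_zeta"
    unfolding zeta_poly_def using is_zeta_poly_W10E by (rule the1_equality)
  obtain x where x: "0 < x" "x < 1 / sqrt q0" "poly W10_zeta x = 0"
    using W10_zeta_real_root by blast
  have "poly (map_poly of_real W10_zeta) (complex_of_real x) = of_real (poly W10_zeta x)"
    by (simp add: W10_zeta_def map_poly_pCons)
  then have "poly (zeta_poly q0 W10E) (of_real x) = 0"
    by (simp add: zeta x)
  \<comment> \<open>Since \<open>x\<close> is positive its modulus is \<open>x\<close> itself,
    strictly below the radius.\<close>
  moreover have "cmod (of_real x) \<noteq> 1 / sqrt q0"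
    using x by (simp add: norm_of_real)
  ultimately have root: "\<exists>T. poly (zeta_poly q0 W10E) T = 0 \<and> cmod T \<noteq> 1 / sqrt q0"
    by blast
  then have "\<not> riemann_hypothesis q0 W10E"
    by (auto simp: riemann_hypothesis_def)
  with ex1 root show ?thesis
    using extremal_W10E sigma_invariant_W10E by blast
qed

end
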